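(* Let $\mathbb{M}$ be a weight sequence satisfying (mg). If there exists $\gamma>0$ such that $\mathcal{A}_{\{\widehat{\mathbb{M}}\}}(S_\gamma)$ contains optimal $\{\mathbb{M}\}$-flat functions, then $\mathbb{M}$ is strongly regular.
   Context: A weight sequence is a sequence $\mathbb{M}=(M_p)_{p\in\mathbb{N}_0}$ of positive real numbers with $M_0=1$, logarithmically convex (lc) ($M_p^2\le M_{p-1}M_{p+1}$, $p\ge1$), and such that $M_{p+1}/M_p\to\infty$. Put $\widehat{\mathbb{M}}:=(p!M_p)_{p\in\mathbb{N}_0}$. (mg): there is $A>0$ with $M_{p+q}\le A^{p+q}M_pM_q$ for all $p,q\in\mathbb{N}_0$. (snq): there is $B>0$ with $\sum_{q=p}^\infty\frac{M_q}{(q+1)M_{q+1}}\le B\frac{M_p}{M_{p+1}}$ for all $p\in\mathbb{N}_0$. $\mathbb{M}$ is strongly regular if it satisfies (lc), (mg) and (snq). $\mathcal{R}$ is the Riemann surface of the logarithm, $S_\gamma:=\{z\in\mathcal{R}:|\arg z|<\gamma\pi/2\}$. $\mathcal{A}_{\{\widehat{\mathbb{M}}\}}(S)$ is the space of holomorphic functions $f$ on $S$ for which there is $A>0$ with $\sup_{z\in S,\,p\in\mathbb{N}_0}\frac{|f^{(p)}(z)|}{A^pp!M_p}<\infty$. With $h_{\mathbb{M}}(t):=\inf_{p\in\mathbb{N}_0}M_pt^p$ for $t>0$, a holomorphic $G\colon S\to\mathbb{C}$ on an unbounded sector $S$ bisected by direction $0$ is an optimal $\{\mathbb{M}\}$-flat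 function in $S$ if there are $K_1,K_2,K_3,K_4>0$ with $K_1h_{\mathbb{M}}(K_2x)\le G(x)$ for all $x>0$ (in particular $G(x)>0$) and $|G(z)|\le K_3h_{\mathbb{M}}(K_4|z|)$ for all $z\in S$. *)

theory Defs
  imports "HOL-Complex_Analysis.Complex_Analysis"
begin

subsection \<open>Weight sequences\<close>

definition log_convex :: "(nat \<Rightarrow> real) \<Rightarrow> bool" where
  "log_convex M \<longleftrightarrow> (\<forall>p\<ge>1. (M p)\<^sup>2 \<le> M (p - 1) * M (p + 1))"

definition weight_sequence :: "(nat \<Rightarrow> real) \<Rightarrow> bool" where
  "weight_sequence M \<longleftrightarrow>
     (\<forall>p. M p > 0) \<and> M 0 = 1 \<and> log_convex M \<and>
     filterlim (\<lambda>p. M (p + 1) / M p) at_top sequentially"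

definition hat_seq :: "(nat \<Rightarrow> real) \<Rightarrow> nat \<Rightarrow> real" where
  "hat_seq M p = fact p * M p"

definition moderate_growth :: "(nat \<Rightarrow> real) \<Rightarrow> bool" where
  "moderate_growth M \<longleftrightarrow> (\<exists>A>0. \<forall>p q. M (p + q) \<le> A ^ (p + q) * M p * M q)"

text \<open>The summation index is shifted by \<open>p\<close>. Summability is required explicitly, since
  the value of a divergent \<^const>\<open>suminf\<close> carries no information.\<close>

definition strongly_nonquasianalytic :: "(nat \<Rightarrow> real) \<Rightarrow> bool" where
  "strongly_nonquasianalytic M \<longleftrightarrow> (\<exists>B>0. \<forall>p.
     summable (\<lambda>k. M (p + k) / (real (p + k + 1) * M (p + k + 1))) \<and>
     (\<Sum>k. M (p + k) / (real (p + k + 1) * M (p + k + 1))) \<le> B * (M p / M (p + 1)))"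

definition strongly_regular :: "(nat \<Rightarrow> real) \<Rightarrow> bool" where
  "strongly_regular M \<longleftrightarrow> log_convex M \<and> moderate_growth M \<and> strongly_nonquasianalytic M"

definition h_fun :: "(nat \<Rightarrow> real) \<Rightarrow> real \<Rightarrow> real" where
  "h_fun M t = (INF p. M p * t ^ p)"


subsection \<open>The Riemann surface of the logarithm\<close>

text \<open>The surface is the universal cover of the punctured plane. The logarithm
  \<open>z \<mapsto> ln \<bar>z\<bar> + \<i> arg z\<close> is a biholomorphic map from it onto the complex plane, so a point
  is given by its logarithm \<open>rs_log z\<close>, and \<open>rs_point\<close> is the inverse map. Arguments
  are arbitrary reals: points with arguments differing by \<open>2\<pi>\<close> are distinct.\<close>

typedef log_surface = "UNIV :: complex set"
  morphisms rs_log rs_point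
  by simp

definition rs_proj :: "log_surface \<Rightarrow> complex" where
  "rs_proj z = exp (rs_log z)"

definition rs_abs :: "log_surface \<Rightarrow> real" where
  "rs_abs z = cmod (rs_proj z)"

definition rs_arg :: "log_surface \<Rightarrow> real" where
  "rs_arg z = Im (rs_log z)"

text \<open>The point with modulus \<open>x > 0\<close> and argument \<open>0\<close>.\<close>

definition rs_pos :: "real \<Rightarrow> log_surface" where
  "rs_pos x = rs_point (complex_of_real (ln x))"

definition sector :: "real \<Rightarrow> log_surface set" where
  "sector \<gamma> = {z. \<bar>rs_arg z\<bar> < \<gamma> * pi / 2}"

definition rs_holomorphic_on :: "(log_surface \<Rightarrow> complex) \<Rightarrow> log_surface set \<Rightarrow> bool" where
  "rs_holomorphic_on f S \<longleftrightarrow> (\<lambda>w. f (rs_point w)) holomorphic_on (rs_log ` S)"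

text \<open>The derivative \<open>df/dz\<close> is taken with respect to the variable \<open>z\<close>, i.e. the local
  coordinate \<open>rs_proj\<close>, and not with respect to \<open>rs_log z\<close>. The limit over surface points
  \<open>v\<close> tending to \<open>z\<close> is a limit over their logarithms.\<close>

definition rs_deriv :: "(log_surface \<Rightarrow> complex) \<Rightarrow> log_surface \<Rightarrow> complex" where
  "rs_deriv f z = Lim (at (rs_log z))
     (\<lambda>w. (f (rs_point w) - f z) / (rs_proj (rs_point w) - rs_proj z))"

lemma rs_log_point [simp]: "rs_log (rs_point w) = w"
  by (simp add: rs_point_inverse)

lemma rs_proj_point [simp]: "rs_proj (rs_point w) = exp w"
  by (simp add: rs_proj_def)

lemma rs_abs_pos: "x > 0 \<Longrightarrow> rs_abs (rs_pos x) = x"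
  by (simp add: rs_abs_def rs_pos_def)

lemma rs_arg_pos: "rs_arg (rs_pos x) = 0"
  by (simp add: rs_arg_def rs_pos_def)

lemma open_log_sector: "open (rs_log ` sector \<gamma>)"
proof -
  have "rs_log ` sector \<gamma> = {w. \<bar>Im w\<bar> < \<gamma> * pi / 2}"
    unfolding sector_def rs_arg_def by (auto intro!: image_eqI[of _ _ "rs_point _"])
  moreover have "open {w. \<bar>Im w\<bar> < \<gamma> * pi / 2}"
    by (intro open_Collect_less continuous_intros)
  ultimately show ?thesis by simp
qed

text \<open>In the logarithmic coordinate, \<open>df/dz\<close> is given by the chain rule.\<close>

lemma rs_deriv_eq:
  assumes "rs_holomorphic_on f S" "open (rs_log ` S)" "z \<in> S"
  shows "rs_deriv f z = deriv (\<lambda>w. f (rs_point w)) (rs_log z) / rs_proj z"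
proof -
  let ?F = "\<lambda>w. f (rs_point w)" and ?a = "rs_log z"
  have "(?F has_field_derivative deriv ?F ?a) (at ?a)"
    using assms unfolding rs_holomorphic_on_def by (blast intro: holomorphic_derivI)
  hence 1: "((\<lambda>w. (?F w - f z) / (w - ?a)) \<longlongrightarrow> deriv ?F ?a) (at ?a)"
    by (simp add: has_field_derivative_iff rs_log_inverse)
  have "(exp has_field_derivative exp ?a) (at ?a)" by (rule DERIV_exp)
  hence 2: "((\<lambda>w. (exp w - exp ?a) / (w - ?a)) \<longlongrightarrow> exp ?a) (at ?a)"
    by (simp add: has_field_derivative_iff)
  have "((\<lambda>w. ((?F w - f z) / (w - ?a)) / ((exp w - exp ?a) / (w - ?a)))
           \<longlongrightarrow> deriv ?F ?a / exp ?a) (at ?a)"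
    by (rule tendsto_divide[OF 1 2]) simp
  hence "((\<lambda>w. (?F w - f z) / (exp w - exp ?a)) \<longlongrightarrow> deriv ?F ?a / exp ?a) (at ?a)"
    by (rule Lim_transform_eventually) (auto simp: eventually_at_filter)
  thus ?thesis
    unfolding rs_deriv_def rs_proj_point rs_proj_def[of z]
    by (intro tendsto_Lim) simp_all
qed


subsection \<open>Ultraholomorphic classes and optimal flat functions\<close>

text \<open>Functions on \<open>S\<close> are represented by total functions; their values off the (open)
  set \<open>S\<close> are irrelevant.\<close>

definition ultraholomorphic_class ::
    "(nat \<Rightarrow> real) \<Rightarrow> log_surface set \<Rightarrow> (log_surface \<Rightarrow> complex) set" where
  "ultraholomorphic_class N S = {f. rs_holomorphic_on f S \<and>
     (\<exists>A>0. bdd_above {cmod ((rs_deriv ^^ p) f z) / (A ^ p * N p) | z p. z \<in> S})}"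

text \<open>The unbounded sectors bisected by direction \<open>0\<close> are the \<open>sector \<gamma>\<close> with
  \<open>\<gamma> > 0\<close>. The bound \<open>K1 h(K2 x) \<le> G(x)\<close> includes that \<open>G(x)\<close> is real.\<close>

definition optimal_flat :: "(nat \<Rightarrow> real) \<Rightarrow> real \<Rightarrow> (log_surface \<Rightarrow> complex) \<Rightarrow> bool" where
  "optimal_flat M \<gamma> G \<longleftrightarrow> \<gamma> > 0 \<and> rs_holomorphic_on G (sector \<gamma>) \<and>
     (\<exists>K1>0. \<exists>K2>0. \<exists>K3>0. \<exists>K4>0.
        (\<forall>x>0. G (rs_pos x) \<in> \<real> \<and> K1 * h_fun M (K2 * x) \<le> Re (G (rs_pos x))) \<and>
        (\<forall>z\<in>sector \<gamma>. cmod (G z) \<le> K3 * h_fun M (K4 * rs_abs z)))"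

end

theory Submission
  imports Defs
begin

text \<open>In the coordinate \<open>w = log z\<close> the flat function is bounded by \<open>K\<^sub>3\<close> on a strip, and on a vertical
  line far to the left of \<open>log x\<close> it is bounded by \<open>K\<^sub>3 H\<close> with \<open>H = M\<^sub>q (K\<^sub>4 r)\<^sup>q\<close>, where \<open>r\<close> is a
  small multiple of \<open>x\<close>. Comparison with a harmonic barrier on a rectangle gives
  \<open>K\<^sub>1 h(K\<^sub>2 x) \<le> K\<^sub>3 H\<^sup>c\<close>, where \<open>c\<close> depends only on the opening of the sector and on \<open>x / r\<close>.
  Let \<open>m\<^sub>p = M\<^sub>p\<^sub>+\<^sub>1 / M\<^sub>p\<close>. Moderate growth yields \<open>h(1/m\<^sub>p) \<ge> A\<^sup>-\<^sup>2\<^sup>p\<close>, and taking \<open>q = k p\<close> with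
  \<open>k\<close> large forces \<open>m\<^sub>k\<^sub>p \<ge> 2 m\<^sub>p\<close>. Summing over the blocks \<open>[k\<^sup>j p, k\<^sup>j\<^sup>+\<^sup>1 p)\<close> then proves (snq).\<close>

subsection \<open>A two-constants estimate in a strip\<close>

text \<open>The maximum principle is applied to \<open>F w * exp (- ln H * V w)\<close> on a closed
  rectangle around \<open>u\<close>. The real part of \<open>V\<close> vanishes on three sides and
  is at most 1 on the left one, so it acts as a barrier; its value at \<open>u\<close> is the
  exponent of \<open>H\<close>.\<close>

lemma two_constants_strip:
  fixes F :: "complex \<Rightarrow> complex" and a K H l u :: real
  assumes hol: "F holomorphic_on {w. \<bar>Im w\<bar> < a}"
    and \<delta>: "0 < \<delta>" "\<delta> < a" and l: "0 < l" and H: "0 < H" "H \<le> 1"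
    and bound: "\<And>w. \<bar>Im w\<bar> < a \<Longrightarrow> cmod (F w) \<le> K"
    and left: "\<And>w. \<bar>Im w\<bar> < a \<Longrightarrow> Re w = u - l \<Longrightarrow> cmod (F w) \<le> K * H"
  shows "cmod (F (of_real u)) \<le>
           K * H powr (sinh (pi / (2 * \<delta>)) / sinh (pi / (2 * \<delta>) * (1 + l)))"
proof -
  define k where "k = pi / (2 * \<delta>)"
  have k: "k > 0" using \<delta> by (simp add: k_def)
  define s where "s = sinh (k * (1 + l))"
  have s: "s > 0" using k l by (simp add: s_def)
  \<comment> \<open>The choice of \<open>k\<close> makes the cosine factor of the real part vanish
    on the sides Im w = \<plusminus>\<delta>, the shift by \<open>u + 1\<close> makes the sinh
    factor vanish on the right side, and \<open>s\<close> normalises that factor to 1 on the left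
    side.\<close>
  define V where "V = (\<lambda>w::complex. sinh (of_real k * (of_real (u + 1) - w)) / of_real s)"
  define P where "P = (\<lambda>w. F w * exp (- of_real (ln H) * V w))"
  define S where "S = cbox (Complex (u - l) (- \<delta>)) (Complex (u + 1) \<delta>)"
  have ReV: "Re (V w) = sinh (k * (u + 1 - Re w)) * cos (k * Im w) / s" for w
    by (simp add: V_def sinh_field_def Re_exp Re_divide_of_real algebra_simps)
  have normP: "cmod (P w) = cmod (F w) * exp (- ln H * Re (V w))" for w
    by (simp add: P_def norm_mult)
  have S_iff: "w \<in> S \<longleftrightarrow> u - l \<le> Re w \<and> Re w \<le> u + 1 \<and> - \<delta> \<le> Im w \<and> Im w \<le> \<delta>" for w
    by (auto simp: S_def in_cbox_complex_iff)
  have S_strip: "S \<subseteq> {w. \<bar>Im w\<bar> < a}" using \<delta> by (auto simp: S_iff)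
  have "V holomorphic_on UNIV"
    unfolding V_def sinh_field_def using s by (intro holomorphic_intros) auto
  hence holP: "P holomorphic_on S"
    unfolding P_def using hol S_strip
    by (intro holomorphic_intros) (auto intro: holomorphic_on_subset)
  have lnH: "ln H \<le> 0" using H by simp
  have K: "K \<ge> 0" using order_trans[OF norm_ge_zero bound[of 0]] \<delta> by simp
  have front: "cmod (P w) \<le> K" if w: "w \<in> frontier S" for w
  proof -
    have wS: "w \<in> S" using w frontier_subset_closed[of S] by (auto simp: S_def)
    have "w \<notin> box (Complex (u - l) (- \<delta>)) (Complex (u + 1) \<delta>)"
      using w by (auto simp: S_def frontier_cbox)
    with wS consider "Re w = u - l" | "Re w = u + 1" | "\<bar>Im w\<bar> = \<delta>"
      by (auto simp: S_iff in_box_complex_iff)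
    thus ?thesis
    proof cases
      case 1
      \<comment> \<open>Since \<open>- ln H\<close> is nonnegative, the exponential factor is at
        most 1/H here, which cancels the extra \<open>H\<close> in the bound for
        \<open>F\<close>.\<close>
      have "Re (V w) = cos (k * Im w)"
        using s by (simp add: ReV 1 s_def[symmetric] add.commute)
      hence "- ln H * Re (V w) \<le> - ln H * 1"
        using lnH by (intro mult_left_mono) auto
      hence "exp (- ln H * Re (V w)) \<le> 1 / H"
        using H by (metis exp_le_cancel_iff exp_ln exp_minus inverse_eq_divide mult.right_neutral)
      moreover have "cmod (F w) \<le> K * H" using left[of w] 1 S_strip wS by auto
      ultimately have "cmod (P w) \<le> (K * H) * (1 / H)"
        unfolding normP using K H by (intro mult_mono) auto
      thus ?thesis using H by simp
    next
      case 2
      hence "Re (V w) = 0" by (simp add: ReV)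
      thus ?thesis using bound[of w] S_strip wS by (auto simp: normP)
    next
      case 3
      have "cos (k * Im w) = cos (k * \<delta>)"
        using 3 by (metis cos_minus abs_if mult_minus_right)
      also have "\<dots> = 0" using \<delta> by (simp add: k_def)
      finally have "Re (V w) = 0" by (simp add: ReV)
      thus ?thesis using bound[of w] S_strip wS by (auto simp: normP)
    qed
  qed
  have uS: "of_real u \<in> S" using l \<delta> by (simp add: S_iff)
  have "cmod (P (of_real u)) \<le> K"
  proof (rule maximum_modulus_frontier[of P S])
    show "P holomorphic_on interior S"
      by (rule holomorphic_on_subset[OF holP interior_subset])
    show "continuous_on (closure S) P"
      using holomorphic_on_imp_continuous_on[OF holP] by (simp add: S_def)
    show "bounded S" by (simp add: S_def)
  qed (use front uS in auto)
  moreover have "Re (V (of_real u)) = sinh k / s" by (simp add: ReV)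
  ultimately have "cmod (F (of_real u)) * exp (- (ln H * (sinh k / s))) \<le> K"
    by (simp add: normP)
  hence "cmod (F (of_real u)) \<le> K * exp (ln H * (sinh k / s))"
    by (simp add: exp_minus field_simps)
  thus ?thesis using H by (simp add: powr_def k_def s_def mult.commute)
qed

subsection \<open>Quotients of a log-convex sequence\<close>

locale log_convex_seq =
  fixes M :: "nat \<Rightarrow> real"
  assumes pos: "M p > 0" and zero: "M 0 = 1" and lc: "log_convex M"
begin

definition m :: "nat \<Rightarrow> real" where
  "m p = M (Suc p) / M p"

lemma m_pos: "m p > 0"
  by (simp add: m_def pos)

lemma M_Suc: "M (Suc p) = M p * m p"
  using pos[of p] by (simp add: m_def)

lemma m_mono: "p \<le> q \<Longrightarrow> m p \<le> m q"
proof (rule lift_Suc_mono_le[of m])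
  fix n
  have "(M (Suc n))\<^sup>2 \<le> M n * M (Suc (Suc n))"
    using lc[unfolded log_convex_def, rule_format, of "Suc n"] by simp
  thus "m n \<le> m (Suc n)"
    using pos[of n] pos[of "Suc n"] by (simp add: m_def field_simps power2_eq_square)
qed

lemma M_add_ge: "M (p + n) \<ge> M p * m p ^ n"
proof (induction n)
  case (Suc n)
  have "M p * m p ^ n * m p \<le> M (p + n) * m (p + n)"
    using Suc pos m_pos by (intro mult_mono m_mono) (auto intro: less_imp_le)
  thus ?case by (simp add: M_Suc mult_ac)
qed simp

text \<open>The ratio of the two values of \<open>M\<close> is the product of \<open>m p\<close>,
  ..., \<open>m (p + n - 1)\<close>. Bounding by \<open>m (p + n)\<close> avoids truncated
  subtraction and is the form used for \<open>h_fun\<close> at \<open>1 / m (p + n)\<close>.\<close>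

lemma M_add_le: "M (p + n) \<le> M p * m (p + n) ^ n"
proof (induction n)
  case (Suc n)
  have "M (p + n) * m (p + n) \<le> M p * m (p + Suc n) ^ n * m (p + Suc n)"
  proof (intro mult_mono)
    have "M (p + n) \<le> M p * m (p + n) ^ n" by (rule Suc)
    also have "\<dots> \<le> M p * m (p + Suc n) ^ n"
      using pos m_pos by (intro mult_left_mono power_mono m_mono) (auto intro: less_imp_le)
    finally show "M (p + n) \<le> M p * m (p + Suc n) ^ n" .
  qed (use pos m_pos in \<open>auto intro: m_mono less_imp_le\<close>)
  thus ?case by (simp add: M_Suc mult_ac)
qed simp

lemma M_le_power: "M q \<le> m q ^ q"
  using M_add_le[of 0 q] by (simp add: zero)

section \<open>Bounds for \<open>h_fun\<close>, in particular at reciprocals of quotients\<close>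

lemma h_fun_le:
  assumes "t \<ge> 0"
  shows "h_fun M t \<le> M q * t ^ q"
  unfolding h_fun_def
  using assms pos by (intro cINF_lower bdd_belowI[of _ 0]) (auto intro: mult_nonneg_nonneg zero_le_power less_imp_le)

text \<open>Passing from \<open>q\<close> to \<open>q + 1\<close> multiplies the term by
  \<open>m q / m p\<close>, which is at most 1 below \<open>p\<close> and at least 1 from
  \<open>p\<close> on; so the smallest term is the one with index \<open>p\<close>.\<close>

lemma h_fun_inverse_m_ge: "h_fun M (1 / m p) \<ge> M p / m p ^ p"
  unfolding h_fun_def
proof (rule cINF_greatest)
  fix q
  show "M p / m p ^ p \<le> M q * (1 / m p) ^ q"
  proof (cases "p \<le> q")
    case True
    then obtain n where "q = p + n" using le_Suc_ex by blast
    thus ?thesis using M_add_ge[of p n] m_pos[of p] by (simp add: field_simps power_add)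
  next
    case False
    then obtain n where "p = q + n" using le_Suc_ex by (meson nat_le_linear)
    thus ?thesis using M_add_le[of q n] m_pos[of p] by (simp add: field_simps power_add)
  qed
qed simp

text \<open>Moderate growth with both indices equal to \<open>p\<close>, compared with
  \<open>M_add_ge\<close>, bounds \<open>m p ^ p\<close> by
  \<open>A ^ (2 * p) * M p\<close>.\<close>

lemma moderate_growth_h_fun_ge:
  assumes "moderate_growth M"
  obtains A where "A \<ge> 1" "\<And>p. h_fun M (1 / m p) \<ge> 1 / A ^ p"
proof -
  from assms obtain A where A: "A > 0" "\<And>p q. M (p + q) \<le> A ^ (p + q) * M p * M q"
    unfolding moderate_growth_def by blast
  define C where "C = max 1 (A\<^sup>2)"
  have "1 / C ^ p \<le> h_fun M (1 / m p)" for p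
  proof -
    have "M p * m p ^ p \<le> A ^ (p + p) * M p * M p"
      using M_add_ge[of p p] A(2)[of p p] by linarith
    hence "m p ^ p \<le> A ^ (p + p) * M p" using pos[of p] by simp
    also have "A ^ (p + p) = (A\<^sup>2) ^ p" by (simp add: power_mult[symmetric] mult_2)
    also have "(A\<^sup>2) ^ p * M p \<le> C ^ p * M p"
      using pos[of p] by (intro mult_right_mono power_mono) (auto simp: C_def)
    finally have "m p ^ p \<le> C ^ p * M p" .
    moreover have "C > 0" by (simp add: C_def)
    ultimately have "1 / C ^ p \<le> M p / m p ^ p"
      using m_pos[of p] by (simp add: field_simps)
    thus ?thesis using h_fun_inverse_m_ge[of p] by linarith
  qed
  thus ?thesis by (intro that[of C]) (auto simp: C_def)
qed

section \<open>From doubling of the quotients to (snq)\<close>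

lemma strongly_nonquasianalytic_if_doubling:
  assumes k: "k \<ge> 2" and dbl: "\<And>p. p \<ge> 1 \<Longrightarrow> m (k * p) \<ge> 2 * m p"
  shows "strongly_nonquasianalytic M"
proof -
  define a where "a q = 1 / (real (q + 1) * m q)" for q
  have a_nonneg: "a q \<ge> 0" for q using m_pos[of q] by (simp add: a_def)
  \<comment> \<open>The bound reproduces itself: the first block costs at most
    \<open>k / m p\<close>, and the induction hypothesis at \<open>k * p\<close> gives
    \<open>2 * k / m (k * p)\<close>, which doubling reduces to another
    \<open>k / m p\<close>.\<close>
  have block: "sum a {p..<k ^ n * p} \<le> 2 * k / m p" if "p \<ge> 1" for n p
    using that
  proof (induction n arbitrary: p)
    case 0
    thus ?case using m_pos[of p] by simp
  next
    case (Suc n)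
    have kp: "k * p \<ge> 1" "p \<le> k * p" "k * p \<le> k ^ Suc n * p"
      using k Suc.prems by (auto simp: Suc_le_eq)
    have "sum a {p..<k * p} \<le> real (card {p..<k * p}) * (1 / (real p * m p))"
    proof (rule sum_bounded_above)
      fix q assume "q \<in> {p..<k * p}"
      hence "real p * m p \<le> real (q + 1) * m q"
        using m_pos[of p] by (intro mult_mono m_mono) (auto intro: less_imp_le)
      thus "a q \<le> 1 / (real p * m p)"
        unfolding a_def using Suc.prems m_pos[of p] m_pos[of q]
        by (intro divide_left_mono mult_pos_pos) auto
    qed
    also have "\<dots> \<le> real (k * p) * (1 / (real p * m p))"
      using m_pos[of p] by (intro mult_right_mono) (auto simp flip: of_nat_mult)
    also have "\<dots> = k / m p" using Suc.prems by simp
    finally have 1: "sum a {p..<k * p} \<le> k / m p" .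
    have "sum a {k * p..<k ^ Suc n * p} \<le> 2 * k / m (k * p)"
      using Suc.IH[OF kp(1)] by (simp add: mult_ac)
    also have "\<dots> \<le> 2 * k / (2 * m p)"
      using dbl[OF Suc.prems] m_pos by (intro divide_left_mono) auto
    finally have 2: "sum a {k * p..<k ^ Suc n * p} \<le> k / m p" by simp
    show ?case
      using 1 2 sum.atLeastLessThan_concat[OF kp(2,3), of a] by simp
  qed
  have tail: "(\<Sum>i<n. a (p + i)) \<le> 2 * k / m p" if p: "p \<ge> 1" for n p
  proof -
    have "n < k ^ n" using k by (intro power_gt_expt) auto
    hence "Suc n * p \<le> k ^ n * p" by (intro mult_right_mono) auto
    moreover have "p + n \<le> Suc n * p" using p by (cases p) auto
    ultimately have "p + n \<le> k ^ n * p" by linarith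
    have "(\<Sum>i<n. a (p + i)) = sum a {p..<p + n}"
      using sum.shift_bounds_nat_ivl[of a 0 p n] by (simp add: atLeast0LessThan add.commute)
    also have "\<dots> \<le> sum a {p..<k ^ n * p}"
      using \<open>p + n \<le> k ^ n * p\<close> a_nonneg by (intro sum_mono2) auto
    also note block[OF p]
    finally show ?thesis .
  qed
  define B where "B = 1 + 2 * real k"
  have partial: "(\<Sum>i<n. a (p + i)) \<le> B * (1 / m p)" for n p
  proof (cases "p = 0")
    case False
    hence "(\<Sum>i<n. a (p + i)) \<le> 2 * k / m p" by (intro tail) auto
    also have "\<dots> \<le> B * (1 / m p)" using m_pos[of p] by (simp add: B_def divide_right_mono)
    finally show ?thesis .
  next
    case True
    \<comment> \<open>Blocks starting at 0 are empty, so the term \<open>a 0\<close> is split off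
      and the tail estimate starts at 1; this term accounts for the summand 1 in
      \<open>B\<close>.\<close>
    have "(\<Sum>i<n. a i) \<le> (\<Sum>i<Suc n. a i)" using a_nonneg by simp
    also have "\<dots> = a 0 + (\<Sum>i<n. a (1 + i))" by (simp add: sum.lessThan_Suc_shift del: sum.lessThan_Suc)
    also have "\<dots> \<le> 1 / m 0 + 2 * k / m 1"
      using tail[of 1 n] by (simp add: a_def)
    also have "\<dots> \<le> 1 / m 0 + 2 * k / m 0"
      using m_mono[of 0 1] m_pos by (intro add_left_mono divide_left_mono) auto
    also have "\<dots> = B * (1 / m 0)" by (simp add: B_def add_divide_distrib)
    finally show ?thesis using True by simp
  qed
  have a_eq: "M (p + i) / (real (p + i + 1) * M (p + i + 1)) = a (p + i)" for p i
    using pos[of "p + i"] by (simp add: a_def m_def)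
  have m_eq: "M p / M (p + 1) = 1 / m p" for p by (simp add: m_def)
  have "summable (\<lambda>i. a (p + i))" for p
    by (rule summableI_nonneg_bounded[OF a_nonneg partial])
  moreover from this have "(\<Sum>i. a (p + i)) \<le> B * (1 / m p)" for p
    by (rule suminf_le_const[OF _ partial])
  moreover have "B > 0" by (simp add: B_def)
  ultimately show ?thesis
    unfolding strongly_nonquasianalytic_def a_eq m_eq by blast
qed

text \<open>If doubling fails at \<open>p\<close>, then at \<open>t = 1 / m p\<close> the hypothesis
  with index \<open>k * p\<close> makes \<open>h_fun\<close> smaller than moderate growth permits.
  The 4 is 2 times 2: one factor offsets the failed doubling, the other leaves a ratio of at most
  1/2.\<close>

lemma strongly_nonquasianalytic_if_h_fun_bound:
  assumes mg: "moderate_growth M" and c: "c > 0" and K: "K > 0"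
    and bound: "\<And>t q. t > 0 \<Longrightarrow> M q * (t / 4) ^ q \<le> 1 \<Longrightarrow>
                  h_fun M t \<le> K * (M q * (t / 4) ^ q) powr c"
  shows "strongly_nonquasianalytic M"
proof -
  obtain A where A: "A \<ge> 1" "\<And>p. h_fun M (1 / m p) \<ge> 1 / A ^ p"
    using moderate_growth_h_fun_ge[OF mg] by blast
  \<comment> \<open>As \<open>D\<close> is at least 1, it is bounded by \<open>D ^ p\<close> for
    positive \<open>p\<close>; hence one \<open>k\<close> serves all \<open>p\<close>.\<close>
  define D where "D = max 1 K"
  have "1 < 2 powr c" using c by simp
  then obtain k0 where k0: "D * A < (2 powr c) ^ k0"
    using real_arch_pow by blast
  have half_powr: "((1 / 2) ^ n) powr c = 1 / (2 powr c) ^ n" for n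
    by (induction n) (simp_all add: powr_mult powr_divide)
  \<comment> \<open>Adding 2 ensures the condition \<open>k \<ge> 2\<close> of the doubling
    criterion.\<close>
  define k where "k = k0 + 2"
  have "(2 powr c) ^ k0 \<le> (2 powr c) ^ k"
    using \<open>1 < 2 powr c\<close> by (intro power_increasing) (auto simp: k_def)
  with k0 have k: "D * A < (2 powr c) ^ k" by linarith
  have "m (k * p) \<ge> 2 * m p" if p: "p \<ge> 1" for p
  proof (rule ccontr)
    assume "\<not> m (k * p) \<ge> 2 * m p"
    hence less: "m (k * p) / (4 * m p) \<le> 1 / 2" using m_pos[of p] by (simp add: field_simps)
    define H where "H = M (k * p) * (1 / m p / 4) ^ (k * p)"
    have H0: "H > 0" using pos m_pos by (simp add: H_def)
    have "H \<le> m (k * p) ^ (k * p) * (1 / m p / 4) ^ (k * p)"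
      unfolding H_def using m_pos[of p] by (intro mult_right_mono M_le_power) auto
    also have "\<dots> = (m (k * p) / (4 * m p)) ^ (k * p)"
      by (simp add: power_mult_distrib[symmetric] mult_ac)
    also have "\<dots> \<le> (1 / 2) ^ (k * p)"
      using less m_pos by (intro power_mono) (auto intro: less_imp_le)
    finally have H: "H \<le> (1 / 2) ^ (k * p)" .
    also have "\<dots> \<le> (1::real)" by (intro power_le_one) auto
    finally have "H \<le> 1" .
    hence "h_fun M (1 / m p) \<le> K * H powr c"
      using bound[of "1 / m p" "k * p"] m_pos[of p] by (simp add: H_def)
    also have "\<dots> \<le> D * ((1 / 2) ^ (k * p)) powr c"
      using H H0 c by (intro mult_mono powr_mono2) (auto simp: D_def)
    also have "D * ((1 / 2) ^ (k * p)) powr c = D * (1 / ((2 powr c) ^ k) ^ p)"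
      by (simp only: half_powr flip: power_mult)
    finally have "1 / A ^ p \<le> D * (1 / ((2 powr c) ^ k) ^ p)"
      using A(2)[of p] by linarith
    hence "((2 powr c) ^ k) ^ p \<le> D * A ^ p"
      using A(1) by (simp add: field_simps)
    also have "\<dots> \<le> D ^ p * A ^ p"
      using A(1) power_increasing[of 1 p D] p by (intro mult_right_mono) (auto simp: D_def)
    also have "\<dots> = (D * A) ^ p" by (simp add: power_mult_distrib)
    also have "\<dots> < ((2 powr c) ^ k) ^ p"
      using k p A(1) by (intro power_strict_mono) (auto simp: D_def)
    finally show False by simp
  qed
  thus ?thesis by (intro strongly_nonquasianalytic_if_doubling[of k]) (auto simp: k_def)
qed

section \<open>From flat functions to an inequality for \<open>h_fun\<close>\<close>

lemma optimal_flat_h_fun_bound: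
  assumes "optimal_flat M \<gamma> G"
  obtains c K where "c > 0" "K > 0"
    "\<And>t q. t > 0 \<Longrightarrow> M q * (t / 4) ^ q \<le> 1 \<Longrightarrow>
       h_fun M t \<le> K * (M q * (t / 4) ^ q) powr c"
proof -
  from assms obtain K1 K2 K3 K4 where \<gamma>: "\<gamma> > 0" and hol: "rs_holomorphic_on G (sector \<gamma>)"
    and K: "K1 > 0" "K2 > 0" "K3 > 0" "K4 > 0"
    and lower: "\<forall>x>0. G (rs_pos x) \<in> \<real> \<and> K1 * h_fun M (K2 * x) \<le> Re (G (rs_pos x))"
    and upper: "\<forall>z\<in>sector \<gamma>. cmod (G z) \<le> K3 * h_fun M (K4 * rs_abs z)"
    unfolding optimal_flat_def by (elim conjE exE) (rule that)
  define a where "a = \<gamma> * pi / 2"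
  have a: "a > 0" using \<gamma> by (simp add: a_def)
  define F where "F = (\<lambda>w. G (rs_point w))"
  have "rs_log ` sector \<gamma> = {w. \<bar>Im w\<bar> < a}"
    unfolding sector_def rs_arg_def a_def by (auto intro!: image_eqI[of _ _ "rs_point _"])
  hence holF: "F holomorphic_on {w. \<bar>Im w\<bar> < a}"
    using hol by (simp add: rs_holomorphic_on_def F_def)
  have upperF: "cmod (F w) \<le> K3 * (M q * (K4 * exp (Re w)) ^ q)" if "\<bar>Im w\<bar> < a" for w q
  proof -
    have "cmod (F w) \<le> K3 * h_fun M (K4 * exp (Re w))"
      using upper[rule_format, of "rs_point w"] that by (simp add: F_def sector_def rs_arg_def rs_abs_def a_def)
    also have "\<dots> \<le> K3 * (M q * (K4 * exp (Re w)) ^ q)"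
      using K by (intro mult_left_mono h_fun_le) auto
    finally show ?thesis .
  qed
  \<comment> \<open>The logarithm puts the left side of the rectangle where
    \<open>K4 * exp (Re w)\<close> is at most \<open>t / 4\<close>; the maximum with 1 keeps
    \<open>l\<close> positive.\<close>
  define l where "l = max 1 (ln (4 * K4 / K2))"
  have l: "l > 0" by (simp add: l_def)
  have "4 * K4 / K2 \<le> exp l"
    using K by (simp add: l_def ln_le_cancel_iff[symmetric] del: ln_le_cancel_iff)
  hence expl: "K4 * exp (- l) \<le> K2 / 4"
    using K by (simp add: exp_minus field_simps)
  \<comment> \<open>This is the exponent of the strip estimate with \<delta> = \<open>a / 2\<close>.
    It depends only on \<open>a\<close> and \<open>l\<close>, so it is uniform in \<open>t\<close>
    and \<open>q\<close>.\<close>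
  define c where "c = sinh (pi / (2 * (a / 2))) / sinh (pi / (2 * (a / 2)) * (1 + l))"
  have c: "c > 0" using a l by (simp add: c_def)
  have "h_fun M t \<le> K3 / K1 * (M q * (t / 4) ^ q) powr c"
    if t: "t > 0" and H1: "M q * (t / 4) ^ q \<le> 1" for t q
  proof -
    \<comment> \<open>At the point \<open>exp u\<close> of the positive axis the lower bound for
      \<open>G\<close> involves exactly \<open>h_fun M t\<close>.\<close>
    define u where "u = ln (t / K2)"
    have expu: "exp u = t / K2" using t K by (simp add: u_def)
    have "cmod (F (of_real u)) \<le> K3 * (M q * (t / 4) ^ q) powr c"
      unfolding c_def
    proof (rule two_constants_strip[OF holF])
      \<comment> \<open>The index 0 gives a bound on the whole strip, because
        \<open>M 0 = 1\<close>.\<close>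
      show "cmod (F w) \<le> K3" if "\<bar>Im w\<bar> < a" for w
        using upperF[OF that, of 0] by (simp add: zero)
      show "cmod (F w) \<le> K3 * (M q * (t / 4) ^ q)" if w: "\<bar>Im w\<bar> < a" "Re w = u - l" for w
      proof -
        have "K4 * exp (Re w) = (K4 * exp (- l)) * (t / K2)"
          using expu by (simp add: w exp_diff exp_minus field_simps)
        also have "\<dots> \<le> K2 / 4 * (t / K2)"
          using expl t K by (intro mult_right_mono) auto
        also have "\<dots> = t / 4" using K by simp
        finally have "K4 * exp (Re w) \<le> t / 4" .
        hence "K3 * (M q * (K4 * exp (Re w)) ^ q) \<le> K3 * (M q * (t / 4) ^ q)"
          using K pos[of q] by (intro mult_left_mono power_mono) auto
        thus ?thesis using upperF[OF w(1), of q] by linarith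
      qed
    qed (use a l t H1 pos in auto)
    moreover have "K1 * h_fun M t \<le> cmod (F (of_real u))"
      using lower[rule_format, of "t / K2"] t K complex_Re_le_cmod[of "F (of_real u)"]
      by (simp add: F_def rs_pos_def u_def)
    ultimately have "K1 * h_fun M t \<le> K3 * (M q * (t / 4) ^ q) powr c" by linarith
    thus ?thesis using K by (simp add: field_simps)
  qed
  thus ?thesis using c K by (intro that[of c "K3 / K1"]) auto
qed

end

theorem theorem3p17:
  fixes M :: "nat \<Rightarrow> real"
  assumes "weight_sequence M"
    and "moderate_growth M"
    and "\<exists>\<gamma>>0. \<exists>G \<in> ultraholomorphic_class (hat_seq M) (sector \<gamma>). optimal_flat M \<gamma> G"
  shows "strongly_regular M"
proof -
  interpret log_convex_seq M
    using assms(1) by unfold_locales (auto simp: weight_sequence_def)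
  obtain \<gamma> G where "optimal_flat M \<gamma> G" using assms(3) by blast
  then obtain c K where "c > 0" "K > 0"
    "\<And>t q. t > 0 \<Longrightarrow> M q * (t / 4) ^ q \<le> 1 \<Longrightarrow>
       h_fun M t \<le> K * (M q * (t / 4) ^ q) powr c"
    using optimal_flat_h_fun_bound by blast
  hence "strongly_nonquasianalytic M"
    by (rule strongly_nonquasianalytic_if_h_fun_bound[OF assms(2)])
  thus ?thesis using lc assms(2) by (simp add: strongly_regular_def)
qed

end
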